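(* Let $r>t\geq 2$ be integers and let $n\geq (r-1)\left\lfloor\frac{r-2}{t-1}\right\rfloor+2$. Then in every edge coloring of $K_n^r$ with $\left\lfloor\frac{r-2}{t-1}\right\rfloor$ colors there is a monochromatic Hamiltonian $t$-tight Berge-cycle.
   Context: $K_n^r$ denotes the complete $r$-uniform hypergraph on $n$ vertices. For $r\geq t\geq 2$, an $r$-uniform $t$-tight Berge-cycle of length $n$ in an $r$-uniform hypergraph consists of a sequence of distinct vertices $v_1,\dots,v_n$ (the core sequence) together with distinct edges $e_1,\dots,e_n$ such that $e_j$ contains $v_j,v_{j+1},\dots,v_{j+t-1}$ (indices modulo $n$). It is Hamiltonian if $n$ equals the number of vertices of the hypergraph, and monochromatic if all of $e_1,\dots,e_n$ have the same color. *)

theory Defs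
  imports Main "HOL-Library.Ramsey" "HOL-Library.FuncSet"
begin

text \<open>
  A hypergraph is given by its vertex set \<open>V\<close> and its set of edges \<open>E\<close>; the edges of the
  complete \<open>r\<close>-uniform hypergraph on \<open>V\<close> are \<open>nsets V r\<close>.
\<close>

definition uniform_hypergraph :: "nat \<Rightarrow> 'a set \<Rightarrow> 'a set set \<Rightarrow> bool" where
  "uniform_hypergraph r V E \<longleftrightarrow> finite V \<and> E \<subseteq> nsets V r"

definition edge_coloring :: "'a set set \<Rightarrow> nat \<Rightarrow> ('a set \<Rightarrow> nat) \<Rightarrow> bool" where
  "edge_coloring E k c \<longleftrightarrow> c \<in> E \<rightarrow> {..<k}"

text \<open>
  Here \<open>vs\<close> is the core sequence and \<open>es\<close> the sequence of edges, both indexed from 0;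
  the length of the cycle is \<open>length vs\<close>.
\<close>

definition tight_berge_cycle ::
    "nat \<Rightarrow> nat \<Rightarrow> 'a set \<Rightarrow> 'a set set \<Rightarrow> 'a list \<Rightarrow> 'a set list \<Rightarrow> bool" where
  "tight_berge_cycle r t V E vs es \<longleftrightarrow>
     2 \<le> t \<and> t \<le> r \<and> uniform_hypergraph r V E \<and>
     distinct vs \<and> set vs \<subseteq> V \<and>
     length es = length vs \<and> distinct es \<and> set es \<subseteq> E \<and>
     (\<forall>j < length vs. \<forall>i < t. vs ! ((j + i) mod length vs) \<in> es ! j)"

definition hamiltonian_tight_berge_cycle ::
    "nat \<Rightarrow> nat \<Rightarrow> 'a set \<Rightarrow> 'a set set \<Rightarrow> 'a list \<Rightarrow> 'a set list \<Rightarrow> bool" where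
  "hamiltonian_tight_berge_cycle r t V E vs es \<longleftrightarrow>
     tight_berge_cycle r t V E vs es \<and> length vs = card V"

definition monochromatic_edges :: "('a set \<Rightarrow> nat) \<Rightarrow> 'a set list \<Rightarrow> bool" where
  "monochromatic_edges c es \<longleftrightarrow> (\<exists>col. \<forall>e \<in> set es. c e = col)"

end

theory Submission
  imports Defs
begin

text \<open>
  Let \<open>k = (r - 2) div (t - 1)\<close> be the number of colours. Call a \<open>t\<close>-set bad in colour \<open>i\<close> if at most
  \<open>r - t\<close> edges of colour \<open>i\<close> contain it, and let \<open>G i\<close> be the graph of those pairs that lie in no
  \<open>t\<close>-set bad in colour \<open>i\<close>. If some \<open>G i\<close> has a Hamiltonian cycle, then all windows of \<open>t\<close> consecutive
  vertices lie in at least \<open>r - t + 1\<close> edges of colour \<open>i\<close>, whereas an edge contains at most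
  \<open>r - t + 1\<close> windows, so Hall's theorem yields distinct edges.
  If no \<open>G i\<close> is Hamiltonian, Chvatal's degree condition and a double count give at most \<open>k + 1\<close>
  vertices containing a non-edge of every \<open>G i\<close>. Enlarging these non-edges to bad \<open>t\<close>-sets
  gives at most \<open>k (t - 1) + 1\<close> vertices, contained in more than \<open>k (r - t)\<close> edges, so some colour \<open>i\<close>
  occurs more than \<open>r - t\<close> times around its bad \<open>t\<close>-set.
\<close>

section \<open>Hall's theorem and distinct representatives\<close>

text \<open>Halmos-Vaughan induction on \<open>card I\<close>: a nonempty proper \<open>J\<close>
  with equality in Hall's condition is matched separately from the rest; if there is none, any index
  may take any representative.\<close>

lemma hall_marriage:
  fixes N :: "'i \<Rightarrow> 'b set"
  assumes "finite I" and "\<And>i. i \<in> I \<Longrightarrow> finite (N i)"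
    and "\<And>J. J \<subseteq> I \<Longrightarrow> card J \<le> card (\<Union>(N ` J))"
  shows "\<exists>f. inj_on f I \<and> (\<forall>i\<in>I. f i \<in> N i)"
  using assms
proof (induction "card I" arbitrary: I N rule: less_induct)
  case less
  note fin = less.prems(1) and finN = less.prems(2) and hall = less.prems(3)
  show ?case
  proof (cases "\<exists>J. J \<noteq> {} \<and> J \<subset> I \<and> card (\<Union>(N ` J)) = card J")
    case True
    then obtain J where J: "J \<noteq> {}" "J \<subset> I" "card (\<Union>(N ` J)) = card J" by blast
    have finJ: "finite J" using J(2) fin finite_subset by blast
    have "\<exists>f. inj_on f J \<and> (\<forall>i\<in>J. f i \<in> N i)"
    proof (rule less.hyps)
      show "card J < card I" using J(2) fin psubset_card_mono by blast
    qed (use J(2) finN hall finJ in blast)+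
    then obtain f where f: "inj_on f J" "\<forall>i\<in>J. f i \<in> N i" by blast
    have "\<exists>g. inj_on g (I - J) \<and> (\<forall>i\<in>I - J. g i \<in> N i - \<Union>(N ` J))"
    proof (rule less.hyps)
      show "card (I - J) < card I"
        using J(1,2) fin by (intro psubset_card_mono) auto
    next
      fix K assume K: "K \<subseteq> I - J"
      then have finK: "finite K" using fin finite_subset by blast
      \<comment> \<open>Hall's condition for \<open>J \<union> K\<close>, minus the equality for
        \<open>J\<close>, leaves the condition for \<open>K\<close> once the sets of
        \<open>J\<close> are removed.\<close>
      have "card J + card K = card (J \<union> K)"
        using K finJ finK by (subst card_Un_disjoint) auto
      also have "\<dots> \<le> card (\<Union>(N ` (J \<union> K)))"
        using K J(2) by (intro hall) auto
      also have "\<Union>(N ` (J \<union> K)) = \<Union>(N ` J) \<union> (\<Union>i\<in>K. N i - \<Union>(N ` J))" by blast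
      also have "card \<dots> \<le> card J + card (\<Union>i\<in>K. N i - \<Union>(N ` J))"
        using card_Un_le J(3) by metis
      finally show "card K \<le> card (\<Union>i\<in>K. N i - \<Union>(N ` J))" by simp
    qed (use fin finN in auto)
    then obtain g where g: "inj_on g (I - J)" "\<forall>i\<in>I - J. g i \<in> N i - \<Union>(N ` J)" by blast
    let ?h = "\<lambda>i. if i \<in> J then f i else g i"
    have "inj_on ?h I"
    proof (rule inj_onI)
      fix x y assume xy: "x \<in> I" "y \<in> I" "?h x = ?h y"
      have "f a \<noteq> g b" if "a \<in> J" "b \<in> I - J" for a b using that f(2) g(2) by fastforce
      then show "x = y"
        using xy f(1) g(1) by (cases "x \<in> J"; cases "y \<in> J") (auto dest: inj_onD, metis)
    qed
    moreover have "\<forall>i\<in>I. ?h i \<in> N i" using f g by auto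
    ultimately show ?thesis by blast
  next
    case False
    show ?thesis
    proof (cases "I = {}")
      case True
      then show ?thesis by simp
    next
      case False
      then obtain i where i: "i \<in> I" by blast
      have "card {i} \<le> card (\<Union>(N ` {i}))" using i by (intro hall) auto
      then obtain x where x: "x \<in> N i" by fastforce
      have "\<exists>g. inj_on g (I - {i}) \<and> (\<forall>j\<in>I - {i}. g j \<in> N j - {x})"
      proof (rule less.hyps)
        show "card (I - {i}) < card I" using i fin by (metis card_Diff1_less)
      next
        fix K assume K: "K \<subseteq> I - {i}"
        show "card K \<le> card (\<Union>j\<in>K. N j - {x})"
        proof (cases "K = {}")
          case False
          \<comment> \<open>A nonempty proper \<open>K\<close> has an element to spare, which pays
            for the removal of \<open>x\<close>.\<close>
          have "K \<subset> I" using K i by blast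
          then have "card K \<noteq> card (\<Union>(N ` K))"
            using \<open>\<nexists>J. J \<noteq> {} \<and> J \<subset> I \<and> card (\<Union>(N ` J)) = card J\<close> False by metis
          moreover have "card K \<le> card (\<Union>(N ` K))" using \<open>K \<subset> I\<close> by (intro hall) auto
          moreover have "(\<Union>j\<in>K. N j - {x}) = \<Union>(N ` K) - {x}" by blast
          moreover have "card (\<Union>(N ` K)) - 1 \<le> card (\<Union>(N ` K) - {x})"
            by (simp add: card_Diff_singleton_if)
          ultimately show ?thesis by simp
        qed simp
      qed (use fin finN in auto)
      then obtain g where g: "inj_on g (I - {i})" "\<forall>j\<in>I - {i}. g j \<in> N j - {x}" by blast
      have "inj_on (g(i := x)) I"
        using g by (auto simp: inj_on_def)
      moreover have "\<forall>j\<in>I. (g(i := x)) j \<in> N j" using g x by auto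
      ultimately show ?thesis by blast
    qed
  qed
qed

text \<open>Hall's condition follows by counting incidences: the indices in \<open>J\<close>
  contribute at least \<open>d\<close> each, the elements of the union at most \<open>d\<close>
  each.\<close>

lemma distinct_representatives_of_degrees:
  fixes N :: "'i \<Rightarrow> 'b set"
  assumes "finite I" and finN: "\<And>i. i \<in> I \<Longrightarrow> finite (N i)" and "0 < d"
    and deg_ge: "\<And>i. i \<in> I \<Longrightarrow> d \<le> card (N i)"
    and deg_le: "\<And>e. card {i \<in> I. e \<in> N i} \<le> d"
  shows "\<exists>f. inj_on f I \<and> (\<forall>i\<in>I. f i \<in> N i)"
proof (rule hall_marriage)
  fix J assume J: "J \<subseteq> I"
  then have finJ: "finite J" using assms(1) finite_subset by blast
  let ?U = "\<Union>(N ` J)"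
  have finU: "finite ?U" using J finJ finN by blast
  have "d * card J \<le> (\<Sum>i\<in>J. card (N i))"
    using J deg_ge by (subst mult.commute, intro sum_bounded_below[where K=d, simplified]) auto
  also have "\<dots> = (\<Sum>i\<in>J. card {e \<in> ?U. e \<in> N i})"
    by (intro sum.cong refl arg_cong[where f=card]) auto
  also have "\<dots> = (\<Sum>e\<in>?U. card {i \<in> J. e \<in> N i})"
    using finJ finU by (intro sum_multicount_gen) auto
  also have "\<dots> \<le> (\<Sum>e\<in>?U. d)"
  proof (rule sum_mono)
    fix e
    have "card {i \<in> J. e \<in> N i} \<le> card {i \<in> I. e \<in> N i}"
      using J assms(1) by (intro card_mono) auto
    then show "card {i \<in> J. e \<in> N i} \<le> d" using deg_le[of e] by simp
  qed
  finally show "card J \<le> card ?U" using \<open>0 < d\<close> by simp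
qed (use assms in auto)

section \<open>Hamiltonian cycles: Ore's degree sum and Chvatal's condition\<close>

definition hamiltonian_cycle :: "'a set \<Rightarrow> 'a set set \<Rightarrow> 'a list \<Rightarrow> bool" where
  "hamiltonian_cycle V E vs \<longleftrightarrow> distinct vs \<and> set vs = V \<and>
     (\<forall>j < length vs. {vs ! j, vs ! (Suc j mod length vs)} \<in> E)"

definition nbrs :: "'a set set \<Rightarrow> 'a \<Rightarrow> 'a set" where
  "nbrs E x = {y. {x, y} \<in> E}"

text \<open>The path is followed from \<open>hd ws\<close> to \<open>ws ! i\<close>, then from
  \<open>last ws\<close> backwards to \<open>ws ! Suc i\<close>; the two crossing pairs join these
  pieces into a cycle.\<close>

lemma hamiltonian_cycle_crossing:
  assumes ws: "distinct ws" "set ws = V"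
    and path: "\<And>j. Suc j < length ws \<Longrightarrow> {ws ! j, ws ! Suc j} \<in> E"
    and i: "Suc i < length ws"
    and cross: "{hd ws, ws ! Suc i} \<in> E" "{last ws, ws ! i} \<in> E"
  shows "\<exists>vs. hamiltonian_cycle V E vs"
proof -
  let ?n = "length ws"
  let ?vs = "take (Suc i) ws @ rev (drop (Suc i) ws)"
  have ne: "ws \<noteq> []" using i by auto
  \<comment> \<open>Reversal puts index \<open>?n + i - j\<close> at position \<open>j > i\<close>,
    so the tail descends from \<open>?n - 1\<close> to \<open>Suc i\<close>.\<close>
  have nth: "?vs ! j = (if j \<le> i then ws ! j else ws ! (?n + i - j))" if "j < ?n" for j
    using that i by (auto simp: nth_append rev_nth min_def less_Suc_eq_le intro!: arg_cong[where f="(!) ws"])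
  have len: "length ?vs = ?n" using i by simp
  have "{?vs ! j, ?vs ! (Suc j mod ?n)} \<in> E" if j: "j < ?n" for j
  proof -
    consider "j < i" | "j = i" | "i < j" "Suc j < ?n" | "Suc j = ?n" "i < j" using j i by linarith
    then show ?thesis
    proof cases
      case 1
      then show ?thesis using nth[of j] nth[of "Suc j"] path[of j] i by simp
    next
      case 2
      then show ?thesis using nth[of j] nth[of "Suc j"] cross(2) i ne
        by (simp add: last_conv_nth insert_commute)
    next
      case 3
      have "?n + i - j = Suc (?n + i - Suc j)" using 3 by simp
      then show ?thesis using nth[of j] nth[of "Suc j"] path[of "?n + i - Suc j"] 3
        by (simp add: insert_commute)
    next
      case 4
      then have "?n + i - j = Suc i" by simp
      then show ?thesis using nth[of j] nth[of 0] 4 cross(1) ne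
        by (simp add: hd_conv_nth insert_commute)
    qed
  qed
  moreover have "distinct ?vs"
    using ws(1) by (simp add: set_take_disj_set_drop_if_distinct)
  moreover have "set ?vs = V"
    using ws(2) by (metis append_take_drop_id set_append set_rev)
  ultimately show ?thesis unfolding hamiltonian_cycle_def by (metis len)
qed

text \<open>The predecessors of neighbours of \<open>hd ws\<close> and the neighbours of
  \<open>last ws\<close> occupy disjoint sets of indices, both avoiding the last index.\<close>

lemma degree_sum_le_if_no_crossing:
  assumes E: "E \<subseteq> nsets V 2"
    and ws: "distinct ws" "set ws = V"  "ws \<noteq> []"
    and nocross: "\<And>i. Suc i < length ws \<Longrightarrow> {hd ws, ws ! Suc i} \<in> E \<Longrightarrow> {last ws, ws ! i} \<in> E \<Longrightarrow> False"
  shows "card (nbrs E (hd ws)) + card (nbrs E (last ws)) < length ws"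
proof -
  let ?n = "length ws"
  let ?S = "{i. Suc i < ?n \<and> {hd ws, ws ! Suc i} \<in> E}"
  let ?T = "{i. Suc i < ?n \<and> {last ws, ws ! i} \<in> E}"
  have n: "0 < ?n" using ws(3) by simp
  have edge: "x \<in> V \<and> y \<in> V \<and> x \<noteq> y" if "{x, y} \<in> E" for x y
    using that E by (metis doubleton_in_nsets_2 subsetD)
  have "nbrs E (hd ws) \<subseteq> (\<lambda>i. ws ! Suc i) ` ?S"
  proof
    fix y assume "y \<in> nbrs E (hd ws)"
    then have y: "{hd ws, y} \<in> E" by (simp add: nbrs_def)
    then obtain m where m: "m < ?n" "y = ws ! m"
      using edge ws(2) by (metis in_set_conv_nth)
    have "m \<noteq> 0" using edge[OF y] m ws(3) by (metis hd_conv_nth)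
    then obtain i where "m = Suc i" using not0_implies_Suc by blast
    then show "y \<in> (\<lambda>i. ws ! Suc i) ` ?S" using m y by auto
  qed
  moreover have fin: "finite ?S" "finite ?T"
    by (rule finite_subset[of _ "{..<?n}"]; auto)+
  ultimately have S: "card (nbrs E (hd ws)) \<le> card ?S"
    by (meson card_image_le card_mono finite_imageI order_trans)
  have "nbrs E (last ws) \<subseteq> (\<lambda>i. ws ! i) ` ?T"
  proof
    fix y assume "y \<in> nbrs E (last ws)"
    then have y: "{last ws, y} \<in> E" by (simp add: nbrs_def)
    then obtain m where m: "m < ?n" "y = ws ! m"
      using edge ws(2) by (metis in_set_conv_nth)
    have "m \<noteq> ?n - 1" using edge[OF y] m ws(3) by (metis last_conv_nth)
    then show "y \<in> (\<lambda>i. ws ! i) ` ?T" using m y by auto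
  qed
  then have T: "card (nbrs E (last ws)) \<le> card ?T"
    using fin by (meson card_image_le card_mono finite_imageI order_trans)
  have "card ?S + card ?T = card (?S \<union> ?T)"
    using nocross fin by (subst card_Un_disjoint) auto
  also have "\<dots> \<le> card {..<?n - 1}" by (rule card_mono) auto
  finally have "card ?S + card ?T \<le> ?n - 1" by simp
  then show ?thesis using S T n by linarith
qed

text \<open>The cycle must use \<open>{u, v}\<close>. Rotated so that this pair closes it, it leaves
  a Hamiltonian path in \<open>E\<close> between \<open>u\<close> and \<open>v\<close>, and a
  crossing would make \<open>E\<close> Hamiltonian.\<close>

lemma ore_degree_sum:
  assumes E: "E \<subseteq> nsets V 2" and n: "3 \<le> card V"
    and nonham: "\<nexists>vs. hamiltonian_cycle V E vs"
    and ham: "hamiltonian_cycle V (insert {u, v} E) vs"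
  shows "card (nbrs E u) + card (nbrs E v) < card V"
proof -
  let ?n = "length vs"
  have vs: "distinct vs" "set vs = V"
    and cyc: "\<And>j. j < ?n \<Longrightarrow> {vs ! j, vs ! (Suc j mod ?n)} \<in> insert {u, v} E"
    using ham by (auto simp: hamiltonian_cycle_def)
  have len: "?n = card V" using vs distinct_card by metis
  obtain m where m: "m < ?n" "{vs ! m, vs ! (Suc m mod ?n)} = {u, v}"
    using nonham cyc vs unfolding hamiltonian_cycle_def by (metis insertE)
  define ws where "ws = rotate (Suc m) vs"
  have wl: "length ws = ?n" by (simp add: ws_def)
  have nth: "ws ! j = vs ! ((Suc m + j) mod ?n)" if "j < ?n" for j
    using that by (simp add: ws_def nth_rotate del: rotate_Suc)
  have ws: "distinct ws" "set ws = V" "ws \<noteq> []"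
    using vs n len by (auto simp: ws_def simp del: rotate_Suc)
  have hd: "hd ws = vs ! (Suc m mod ?n)" using nth[of 0] n len ws by (simp add: hd_conv_nth)
  have "Suc m + (?n - 1) = m + ?n" using m(1) by linarith
  then have "(Suc m + (?n - 1)) mod ?n = m" using m(1) by simp
  then have last: "last ws = vs ! m" using nth[of "?n - 1"] n len ws wl
    by (simp add: last_conv_nth)
  have uv: "{hd ws, last ws} = {u, v}" using hd last m(2) by (simp add: insert_commute)
  have path: "{ws ! j, ws ! Suc j} \<in> E" if j: "Suc j < length ws" for j
  proof -
    have "Suc ((Suc m + j) mod ?n) mod ?n = (Suc m + Suc j) mod ?n"
      by (simp add: mod_Suc_eq)
    moreover have "(Suc m + j) mod ?n < ?n" using m(1) by (intro mod_less_divisor) linarith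
    ultimately have "{ws ! j, ws ! Suc j} \<in> insert {u, v} E"
      using cyc[of "(Suc m + j) mod ?n"] nth[of j] nth[of "Suc j"] j wl by simp
    \<comment> \<open>With only two vertices a path edge could equal the closing pair;
      \<open>3 \<le> card V\<close> excludes this.\<close>
    moreover have "{ws ! j, ws ! Suc j} \<noteq> {ws ! 0, ws ! (?n - 1)}"
      using ws(1) j wl n len by (auto simp: doubleton_eq_iff nth_eq_iff_index_eq)
    ultimately show ?thesis using uv ws wl by (simp add: hd_conv_nth last_conv_nth)
  qed
  have "card (nbrs E (hd ws)) + card (nbrs E (last ws)) < length ws"
    using hamiltonian_cycle_crossing[OF ws(1,2) path] nonham
    by (intro degree_sum_le_if_no_crossing[OF E ws]) blast
  then show ?thesis using uv wl len by (auto simp: doubleton_eq_iff)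
qed

lemma hamiltonian_cycle_complete:
  assumes "finite V" "2 \<le> card V"
  shows "\<exists>vs. hamiltonian_cycle V (nsets V 2) vs"
proof -
  obtain vs where vs: "set vs = V" "distinct vs" using assms(1) finite_distinct_list by blast
  then have len: "length vs = card V" using distinct_card by fastforce
  have "{vs ! j, vs ! (Suc j mod length vs)} \<in> nsets V 2" if "j < length vs" for j
  proof -
    have "Suc j mod length vs < length vs" using assms len by (intro mod_less_divisor) linarith
    moreover have "Suc j mod length vs \<noteq> j" using that len assms(2)
      by (cases "Suc j = length vs") auto
    ultimately show ?thesis using that vs by (auto simp: nth_eq_iff_index_eq)
  qed
  then show ?thesis using vs unfolding hamiltonian_cycle_def by blast
qed

text \<open>
  Chvatal's argument: in an edge-maximal non-Hamiltonian supergraph take a non-adjacent pair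
  \<open>u\<close>, \<open>v\<close> of maximal degree sum with \<open>u\<close> of the smaller degree \<open>h\<close>; by Ore's bound \<open>v\<close> has at
  least \<open>h\<close> non-neighbours, and by maximality each of them has degree at most \<open>h\<close>.
\<close>

lemma nonhamiltonian_low_degrees:
  assumes "finite V" and n: "3 \<le> card V" and "E \<subseteq> nsets V 2"
    and "\<nexists>vs. hamiltonian_cycle V E vs"
  shows "\<exists>h J. 2 * h < card V \<and> J \<subseteq> V \<and> J \<noteq> {} \<and> h \<le> card J \<and> (\<forall>s\<in>J. card (nbrs E s) \<le> h)"
  using assms(3,4)
\<comment> \<open>Induction on the number of absent pairs stands in for an edge-maximal supergraph:
  degree bounds for \<open>insert e E\<close> pass down to \<open>E\<close>.\<close>
proof (induction "card (nsets V 2 - E)" arbitrary: E rule: less_induct)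
  case less
  note E = less.prems(1) and nonham = less.prems(2)
  have fin2: "finite (nsets V 2)" using assms(1) by (rule finite_imp_finite_nsets)
  have edge: "x \<in> V \<and> y \<in> V \<and> x \<noteq> y" if "{x, y} \<in> F" "F \<subseteq> nsets V 2" for x y F
    using that by (metis doubleton_in_nsets_2 subsetD)
  have finnb: "finite (nbrs F x)" if "F \<subseteq> nsets V 2" for F x
    by (rule finite_subset[OF _ assms(1)]) (use that edge in \<open>auto simp: nbrs_def\<close>)
  show ?case
  proof (cases "\<exists>e \<in> nsets V 2 - E. \<nexists>vs. hamiltonian_cycle V (insert e E) vs")
    case True
    then obtain e where e: "e \<in> nsets V 2 - E" "\<nexists>vs. hamiltonian_cycle V (insert e E) vs" by blast
    have sub: "insert e E \<subseteq> nsets V 2" using e E by blast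
    have "card (nsets V 2 - insert e E) < card (nsets V 2 - E)"
      using e fin2 by (intro psubset_card_mono) auto
    from less.hyps[OF this sub e(2)] obtain h J where hJ: "2 * h < card V" "J \<subseteq> V" "J \<noteq> {}" "h \<le> card J"
      "\<forall>s\<in>J. card (nbrs (insert e E) s) \<le> h" by blast
    have "card (nbrs E s) \<le> card (nbrs (insert e E) s)" for s
      by (rule card_mono[OF finnb[OF sub]]) (auto simp: nbrs_def)
    then show ?thesis using hJ by (meson order_trans)
  next
    case False
    let ?P = "{(u, v). u \<in> V \<and> v \<in> V \<and> u \<noteq> v \<and> {u, v} \<notin> E}"
    let ?w = "\<lambda>(u, v). card (nbrs E u) + card (nbrs E v)"
    have "finite ?P" by (rule finite_subset[of _ "V \<times> V"]) (use assms(1) in auto)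
    have "E \<noteq> nsets V 2" using nonham hamiltonian_cycle_complete[OF assms(1)] n by fastforce
    then obtain e where "e \<in> nsets V 2" "e \<notin> E" using E by blast
    then have "?P \<noteq> {}" by (auto simp: nsets_2_eq)
    then obtain p where p1: "p \<in> ?P" "Max (?w ` ?P) = ?w p"
      by (rule obtains_MAX[OF \<open>finite ?P\<close>])
    have p: "p \<in> ?P" "\<forall>q\<in>?P. ?w q \<le> ?w p"
      unfolding p1(2)[symmetric] using p1(1) \<open>finite ?P\<close> by (blast, intro ballI Max_ge) auto
    obtain a b where ab: "p = (a, b)" by (cases p)
    have "\<exists>u v. (u, v) \<in> ?P \<and> (\<forall>q\<in>?P. ?w q \<le> ?w (u, v)) \<and> card (nbrs E u) \<le> card (nbrs E v)"
    proof (cases "card (nbrs E a) \<le> card (nbrs E b)")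
      case True
      then show ?thesis using p ab by blast
    next
      case False
      have "(b, a) \<in> ?P" "?w (b, a) = ?w p" using p(1) ab by (auto simp: insert_commute)
      then have "(b, a) \<in> ?P \<and> (\<forall>q\<in>?P. ?w q \<le> ?w (b, a))" using p(2) by presburger
      then show ?thesis using False by (meson nle_le)
    qed
    then obtain u v where uv: "u \<in> V" "v \<in> V" "u \<noteq> v" "{u, v} \<notin> E"
      and mx: "\<forall>q\<in>?P. ?w q \<le> ?w (u, v)" and le: "card (nbrs E u) \<le> card (nbrs E v)" by blast
    have "{u, v} \<in> nsets V 2 - E" using uv by simp
    then obtain vs where "hamiltonian_cycle V (insert {u, v} E) vs" using False by blast
    then have sum: "card (nbrs E u) + card (nbrs E v) < card V"
      by (rule ore_degree_sum[OF E n nonham])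
    let ?J = "V - {v} - nbrs E v"
    have nbv: "nbrs E v \<subseteq> V - {v}" using edge E by (auto simp: nbrs_def)
    have "card ?J = card V - 1 - card (nbrs E v)"
      using nbv finnb[OF E] uv(2) by (simp add: card_Diff_subset assms(1))
    then have "card (nbrs E u) \<le> card ?J" using sum by linarith
    moreover have "u \<in> ?J" using uv by (auto simp: nbrs_def insert_commute)
    moreover have "card (nbrs E s) \<le> card (nbrs E u)" if "s \<in> ?J" for s
    proof -
      have "(s, v) \<in> ?P" using that uv by (auto simp: nbrs_def insert_commute)
      then have "?w (s, v) \<le> ?w (u, v)" using mx by blast
      then show ?thesis by simp
    qed
    moreover have "2 * card (nbrs E u) < card V" using sum le by linarith
    ultimately show ?thesis by (intro exI[of _ "card (nbrs E u)"] exI[of _ ?J]) blast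
  qed
qed

section \<open>Few vertices meeting a non-edge of every graph\<close>

text \<open>
  Let \<open>U i\<close> be the set of vertices adjacent to all others in \<open>G i\<close>. As \<open>card (U i) \<le> card (J i)\<close>,
  double counting gives a vertex \<open>x\<close> lying in at most as many \<open>U i\<close> as \<open>J j\<close>. Colours \<open>j\<close> with
  \<open>x \<notin> U j\<close> are served by a non-neighbour \<open>y j\<close> of \<open>x\<close>. Each colour \<open>i\<close> with \<open>x \<in> U i\<close> is matched
  with a \<open>j\<close> such that \<open>x \<in> J j\<close>; since \<open>h i + h j < card V\<close>, one can choose \<open>y j \<notin> U i\<close>, and then
  \<open>i\<close> is served by a non-neighbour of \<open>y j\<close>.
\<close>

lemma rainbow_nonedges:
  fixes G :: "nat \<Rightarrow> 'a set set"
  assumes fin: "finite V" and n: "3 \<le> card V"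
    and G: "\<And>i. i < k \<Longrightarrow> G i \<subseteq> nsets V 2"
    and nonham: "\<And>i. i < k \<Longrightarrow> \<nexists>vs. hamiltonian_cycle V (G i) vs"
  shows "\<exists>A \<subseteq> V. card A \<le> Suc k \<and> (\<forall>i<k. \<exists>x\<in>A. \<exists>y\<in>A. x \<noteq> y \<and> {x, y} \<notin> G i)"
proof -
  have "\<forall>i. \<exists>h J. i < k \<longrightarrow> 2 * h < card V \<and> J \<subseteq> V \<and> J \<noteq> {} \<and> h \<le> card J \<and>
      (\<forall>s\<in>J. card (nbrs (G i) s) \<le> h)"
    using nonhamiltonian_low_degrees[OF fin n G nonham] by meson
  then obtain h J where "\<forall>i. i < k \<longrightarrow> 2 * h i < card V \<and> J i \<subseteq> V \<and> J i \<noteq> {} \<and>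
      h i \<le> card (J i) \<and> (\<forall>s\<in>J i. card (nbrs (G i) s) \<le> h i)"
    by metis
  then have h: "\<And>i. i < k \<Longrightarrow> 2 * h i < card V"
    and JV: "\<And>i. i < k \<Longrightarrow> J i \<subseteq> V" and Jne: "\<And>i. i < k \<Longrightarrow> J i \<noteq> {}"
    and hJ: "\<And>i. i < k \<Longrightarrow> h i \<le> card (J i)"
    and deg: "\<And>i s. i < k \<Longrightarrow> s \<in> J i \<Longrightarrow> card (nbrs (G i) s) \<le> h i"
    by blast+
  have nbV: "nbrs (G i) x \<subseteq> V - {x}" if "i < k" for i x
  proof
    fix y assume "y \<in> nbrs (G i) x"
    then have "{x, y} \<in> nsets V 2" using G[OF that] unfolding nbrs_def by blast
    then show "y \<in> V - {x}" by auto
  qed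
  have finnb: "finite (nbrs (G i) x)" if "i < k" for i x
    using nbV[OF that, of x] fin by (meson finite_Diff finite_subset)
  define U where "U i = {x \<in> V. \<forall>y\<in>V. y \<noteq> x \<longrightarrow> {x, y} \<in> G i}" for i
  have finU: "finite (U i)" for i using fin by (simp add: U_def)
  \<comment> \<open>A vertex of \<open>U i\<close> has degree \<open>card V - 1\<close>, which
    exceeds \<open>h i\<close> because \<open>2 * h i < card V\<close>.\<close>
  have UJ: "U i \<inter> J i = {}" if "i < k" for i
  proof (rule ccontr)
    assume "U i \<inter> J i \<noteq> {}"
    then obtain s where s: "s \<in> U i" "s \<in> J i" by blast
    have "V - {s} \<subseteq> nbrs (G i) s" using s(1) by (auto simp: U_def nbrs_def)
    then have "card (V - {s}) \<le> h i" using deg[OF that s(2)] finnb[OF that, of s] card_mono order_trans by blast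
    moreover have "card (V - {s}) = card V - 1" using s(2) JV[OF that] by auto
    ultimately show False using h[OF that] n by linarith
  qed
  \<comment> \<open>All of \<open>U i\<close> is adjacent to any fixed vertex of \<open>J i\<close>,
    whose degree is at most \<open>h i\<close>.\<close>
  have Uh: "card (U i) \<le> h i" if i: "i < k" for i
  proof -
    obtain s where s: "s \<in> J i" using Jne[OF i] by blast
    have "U i \<subseteq> nbrs (G i) s"
    proof
      fix x assume x: "x \<in> U i"
      then have "s \<noteq> x" "s \<in> V" using UJ[OF i] s JV[OF i] by auto
      then have "{x, s} \<in> G i" using x by (simp add: U_def)
      then show "x \<in> nbrs (G i) s" by (simp add: nbrs_def insert_commute)
    qed
    then show ?thesis using deg[OF i s] finnb[OF i, of s] card_mono order_trans by blast
  qed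
  let ?R = "\<lambda>x. {i \<in> {..<k}. x \<in> U i}" and ?L = "\<lambda>x. {i \<in> {..<k}. x \<in> J i}"
  have "\<exists>x\<in>V. card (?R x) \<le> card (?L x)"
  proof (rule ccontr)
    assume "\<not> ?thesis"
    then have "(\<Sum>x\<in>V. card (?L x)) < (\<Sum>x\<in>V. card (?R x))"
      using fin n by (intro sum_strict_mono) (auto simp: not_le)
    also have "\<dots> = (\<Sum>i<k. card {x \<in> V. x \<in> U i})"
      using fin by (intro sum_multicount_gen) auto
    also have "\<dots> \<le> (\<Sum>i<k. card {x \<in> V. x \<in> J i})"
    proof (rule sum_mono)
      fix i assume "i \<in> {..<k}"
      then have i: "i < k" by simp
      have "{x \<in> V. x \<in> U i} = U i" "{x \<in> V. x \<in> J i} = J i" using JV[OF i] by (auto simp: U_def)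
      then show "card {x \<in> V. x \<in> U i} \<le> card {x \<in> V. x \<in> J i}"
        using Uh[OF i] hJ[OF i] by simp
    qed
    also have "\<dots> = (\<Sum>x\<in>V. card (?L x))"
      using fin by (intro sum_multicount_gen[symmetric]) auto
    finally show False by simp
  qed
  then obtain x where x: "x \<in> V" "card (?R x) \<le> card (?L x)" by blast
  obtain f where f: "f ` ?R x \<subseteq> ?L x" "inj_on f (?R x)"
    using card_le_inj[OF _ _ x(2)] by auto
  have ex_y: "\<exists>y\<in>V. y \<noteq> x \<and> {x, y} \<notin> G j \<and> (\<forall>i\<in>?R x. f i = j \<longrightarrow> y \<notin> U i)"
    if j: "j < k" "x \<notin> U j" for j
  proof (cases "\<exists>i\<in>?R x. f i = j")
    case True
    then obtain i where i: "i < k" "x \<in> U i" "f i = j" by auto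
    have uniq: "i' = i" if "i' \<in> ?R x" "f i' = j" for i'
      using that i f(2) by (auto dest: inj_onD)
    have xj: "x \<in> J j" using f(1) i by auto
    \<comment> \<open>The right-hand side has at most \<open>h j + (h i - 1)\<close> elements, since
      \<open>x\<close> itself is in \<open>U i\<close>; this is below
      \<open>card V - 1\<close>.\<close>
    have "\<not> V - {x} \<subseteq> nbrs (G j) x \<union> (U i - {x})"
    proof
      assume "V - {x} \<subseteq> nbrs (G j) x \<union> (U i - {x})"
      then have "card (V - {x}) \<le> card (nbrs (G j) x \<union> (U i - {x}))"
        using finnb[OF j(1), of x] finU by (intro card_mono) auto
      also have "\<dots> \<le> card (nbrs (G j) x) + card (U i - {x})" by (rule card_Un_le)
      also have "\<dots> \<le> h j + (h i - 1)"
        using deg[OF j(1) xj] Uh[OF i(1)] i(2) finU[of i] by (intro add_mono) auto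
      finally have "card V - 1 \<le> h j + (h i - 1)" using x(1) by simp
      moreover have "1 \<le> card (U i)" using i(2) finU[of i] by (metis One_nat_def Suc_leI card_gt_0_iff empty_iff)
      ultimately show False using h[OF i(1)] h[OF j(1)] Uh[OF i(1)] by linarith
    qed
    then obtain y where "y \<in> V" "y \<noteq> x" "{x, y} \<notin> G j" "y \<notin> U i" by (auto simp: nbrs_def)
    then show ?thesis using uniq by metis
  next
    case False
    moreover obtain y where "y \<in> V" "y \<noteq> x" "{x, y} \<notin> G j" using j(2) x(1) by (auto simp: U_def)
    ultimately show ?thesis by blast
  qed
  define y where "y j = (SOME y. y \<in> V \<and> y \<noteq> x \<and> {x, y} \<notin> G j \<and> (\<forall>i\<in>?R x. f i = j \<longrightarrow> y \<notin> U i))" for j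
  have y: "y j \<in> V \<and> y j \<noteq> x \<and> {x, y j} \<notin> G j \<and> (\<forall>i\<in>?R x. f i = j \<longrightarrow> y j \<notin> U i)"
    if "j < k" "x \<notin> U j" for j
    unfolding y_def by (rule someI_ex[OF ex_y[OF that, unfolded Bex_def]])
  \<comment> \<open>\<open>x\<close> lies in \<open>J (f i)\<close>, hence not in
    \<open>U (f i)\<close>, so \<open>y (f i)\<close> is a proper choice.\<close>
  have fi: "f i < k \<and> x \<notin> U (f i)" if "i < k" "x \<in> U i" for i
    using that f(1) UJ[of "f i"] by auto
  have "\<exists>z\<in>V. z \<noteq> y (f i) \<and> {y (f i), z} \<notin> G i" if "i < k" "x \<in> U i" for i
  proof -
    have "y (f i) \<in> V - U i" using y[of "f i"] fi[OF that] that by auto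
    then show ?thesis by (auto simp: U_def)
  qed
  then obtain z where z: "\<And>i. i < k \<Longrightarrow> x \<in> U i \<Longrightarrow> z i \<in> V \<and> z i \<noteq> y (f i) \<and> {y (f i), z i} \<notin> G i"
    by metis
  define w where "w i = (if x \<in> U i then z i else y i)" for i
  \<comment> \<open>Besides \<open>x\<close> there is one vertex per colour: \<open>y (f i)\<close>
    takes no extra place, being \<open>w (f i)\<close>.\<close>
  let ?A = "insert x (w ` {..<k})"
  have "?A \<subseteq> V" using x(1) y z by (auto simp: w_def)
  moreover have "card ?A \<le> Suc k"
    by (metis card_image_le card_insert_le_m1 card_lessThan diff_Suc_1 finite_lessThan zero_less_Suc)
  moreover have "\<exists>a\<in>?A. \<exists>b\<in>?A. a \<noteq> b \<and> {a, b} \<notin> G i" if i: "i < k" for i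
  proof (cases "x \<in> U i")
    case True
    have "w (f i) = y (f i)" "w i = z i" "f i < k" using fi[OF i True] True by (auto simp: w_def)
    then have "y (f i) \<in> ?A" "z i \<in> ?A" using i by (metis imageI insertI2 lessThan_iff)+
    then show ?thesis using z[OF i True] by metis
  next
    case False
    have "y i \<in> ?A" using i False by (metis imageI insertI2 lessThan_iff w_def)
    then show ?thesis using y[OF i False] by (metis insertI1)
  qed
  ultimately show ?thesis by blast
qed

section \<open>Windows of consecutive vertices inside an edge\<close>

lemma inj_on_add_mod:
  fixes m n t :: nat
  assumes "t \<le> n"
  shows "inj_on (\<lambda>l. (m + l) mod n) {..<t}"
proof (rule linorder_inj_onI)
  fix a b assume ab: "a < b" "a \<in> {..<t}" "b \<in> {..<t}"
  show "(m + a) mod n \<noteq> (m + b) mod n"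
  proof
    assume "(m + a) mod n = (m + b) mod n"
    then have "n dvd (m + b) - (m + a)"
      using ab by (metis mod_eq_dvd_iff_nat add_left_mono less_imp_le)
    then have "n \<le> b - a" using ab by (auto dest: dvd_imp_le)
    then show False using ab assms by simp
  qed
qed auto

text \<open>Of the \<open>r\<close> positions of vertices of \<open>e\<close>, at least
  \<open>t - 1\<close> start no window inside \<open>e\<close>: after a start \<open>m\<close> whose
  successor is not a start, position \<open>m + t\<close> is outside \<open>e\<close> and spoils the
  windows at \<open>m + 1, ..., m + t - 1\<close>.\<close>

lemma card_windows_in_edge:
  assumes vs: "distinct vs" and t: "0 < t"
    and e: "e \<subseteq> set vs" "card e = r" "r < length vs" "t \<le> r"
  shows "card {j \<in> {..<length vs}. \<forall>i<t. vs ! ((j + i) mod length vs) \<in> e} \<le> r - t + 1"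
proof -
  let ?n = "length vs"
  let ?P = "{j \<in> {..<?n}. vs ! j \<in> e}"
  let ?M = "{j \<in> {..<?n}. \<forall>i<t. vs ! ((j + i) mod ?n) \<in> e}"
  have n: "0 < ?n" using e(3) by linarith
  have "(\<lambda>j. vs ! j) ` ?P = e"
    using e(1) by (auto simp: in_set_conv_nth image_iff) (metis in_set_conv_nth subsetD)
  moreover have "inj_on (\<lambda>j. vs ! j) ?P" using vs by (auto simp: inj_on_def nth_eq_iff_index_eq)
  ultimately have cP: "card ?P = r" using e(2) card_image by fastforce
  show ?thesis
  proof (cases "?M = {}")
    case False
    \<comment> \<open>Otherwise \<open>?M\<close> is closed under cyclic successor, so
      \<open>e\<close> contains every vertex, contrary to \<open>r < length vs\<close>.\<close>
    have "\<exists>m\<in>?M. Suc m mod ?n \<notin> ?M"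
    proof (rule ccontr)
      assume "\<not> ?thesis"
      then have step: "Suc m mod ?n \<in> ?M" if "m \<in> ?M" for m using that by blast
      from False obtain m where m: "m \<in> ?M" by blast
      have all: "(m + q) mod ?n \<in> ?M" for q
      proof (induction q)
        case 0
        then show ?case using m by simp
      next
        case (Suc q)
        then show ?case using step[OF Suc] by (simp add: mod_Suc_eq)
      qed
      have "j \<in> ?P" if "j < ?n" for j
      proof -
        have "m < ?n" using m by simp
        then have "(m + (?n - m + j)) mod ?n = j" using that by simp
        then have "j \<in> ?M" using all[of "?n - m + j"] by metis
        then have "vs ! ((j + 0) mod ?n) \<in> e" using t by blast
        then show ?thesis using that by simp
      qed
      then have "?P = {..<?n}" by blast
      then show False using cP e(3) by simp
    qed
    then obtain m where m: "m \<in> ?M" "Suc m mod ?n \<notin> ?M" by blast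
    have bound: "(m + i) mod ?n < ?n" for i using n by simp
    have in_e: "vs ! ((m + i) mod ?n) \<in> e" if "i < t" for i using m(1) that by blast
    have "Suc m mod ?n < ?n" using n by simp
    then obtain i where i: "i < t" "vs ! ((Suc m mod ?n + i) mod ?n) \<notin> e" using m(2) by blast
    have "(Suc m mod ?n + i) mod ?n = (m + Suc i) mod ?n" by (simp add: mod_add_left_eq)
    then have "vs ! ((m + Suc i) mod ?n) \<notin> e" using i(2) by simp
    moreover from this have "\<not> Suc i < t" using in_e by blast
    \<comment> \<open>The window at \<open>m + 1\<close> adds only position \<open>m + t\<close> to
      the window at \<open>m\<close>, so the vertex outside \<open>e\<close> is there.\<close>
    ultimately have out: "vs ! ((m + t) mod ?n) \<notin> e" using i(1) by (metis Suc_lessI)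
    let ?Q = "(\<lambda>l. (m + l) mod ?n) ` {1..<t}"
    have "inj_on (\<lambda>l. (m + l) mod ?n) {1..<t}"
      by (rule inj_on_subset[OF inj_on_add_mod[of t ?n m]]) (use e(3,4) in auto)
    then have cQ: "card ?Q = t - 1" by (simp add: card_image)
    have "?Q \<subseteq> ?P" using in_e bound by auto
    moreover have "?Q \<inter> ?M = {}"
    proof (rule ccontr)
      assume "?Q \<inter> ?M \<noteq> {}"
      then obtain q where q: "q \<in> ?Q" "q \<in> ?M" by blast
      then obtain l where "l \<in> {1..<t}" "q = (m + l) mod ?n" by blast
      with q(2) have l: "1 \<le> l" "l < t" "(m + l) mod ?n \<in> ?M" by (simp_all only: atLeastLessThan_iff)
      then have "t - l < t" by simp
      then have "vs ! (((m + l) mod ?n + (t - l)) mod ?n) \<in> e" using l(3) by blast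
      moreover have "((m + l) mod ?n + (t - l)) mod ?n = (m + l + (t - l)) mod ?n"
        by (rule mod_add_left_eq)
      ultimately show False using out l(2) by simp
    qed
    moreover have "?M \<subseteq> ?P"
    proof
      fix j assume j: "j \<in> ?M"
      then have "vs ! ((j + 0) mod ?n) \<in> e" using t by blast
      then show "j \<in> ?P" using j by simp
    qed
    ultimately have "card ?M \<le> card (?P - ?Q)" by (intro card_mono) auto
    also have "\<dots> = r - (t - 1)" using \<open>?Q \<subseteq> ?P\<close> cP cQ by (subst card_Diff_subset) auto
    finally show ?thesis using t e(4) by simp
  next
    case True
    then have "card ?M = 0" by (simp only: card.empty)
    then show ?thesis by linarith
  qed
qed

section \<open>Counting edges through a vertex set\<close>

lemma binomial_ge_self:
  assumes "0 < j" "j < m"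
  shows "m \<le> m choose j"
  using assms
proof (induction m arbitrary: j)
  case (Suc m)
  obtain i where i: "j = Suc i" using Suc.prems(1) by (cases j) auto
  show ?case
  proof (cases "Suc i = m")
    case True
    then show ?thesis using i by (metis Suc_n_not_le_n binomial_Suc_n le_refl)
  next
    case False
    then have "m \<le> m choose Suc i" using Suc i by simp
    moreover have "0 < m choose i" using Suc.prems i by simp
    ultimately show ?thesis unfolding i binomial_Suc_Suc by linarith
  qed
qed simp

text \<open>The edges arise by adding \<open>r - card U\<close> vertices from \<open>V - U\<close>;
  this number is positive and below \<open>card (V - U)\<close>, so the binomial coefficient is at
  least \<open>card (V - U)\<close>.\<close>

lemma card_supersets_ge:
  assumes "finite V" "U \<subseteq> V" "card U < r" "r < card V"
  shows "card V - card U \<le> card {e \<in> nsets V r. U \<subseteq> e}"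
proof -
  have finU: "finite U" using assms finite_subset by blast
  have finN: "finite (nsets V r)" using assms(1) by (rule finite_imp_finite_nsets)
  have "card V - card U = card (V - U)" using assms finU by (simp add: card_Diff_subset)
  also have "\<dots> \<le> card (V - U) choose (r - card U)"
    using assms finU by (intro binomial_ge_self) (auto simp: card_Diff_subset)
  also have "\<dots> = card {K. K \<subseteq> V - U \<and> card K = r - card U}"
    using assms by (intro n_subsets[symmetric]) auto
  also have "\<dots> \<le> card {e \<in> nsets V r. U \<subseteq> e}"
  proof (rule card_inj_on_le)
    show "inj_on (\<lambda>K. U \<union> K) {K. K \<subseteq> V - U \<and> card K = r - card U}"
      by (auto simp: inj_on_def)
    show "(\<lambda>K. U \<union> K) ` {K. K \<subseteq> V - U \<and> card K = r - card U} \<subseteq> {e \<in> nsets V r. U \<subseteq> e}"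
    proof clarify
      fix K assume K: "K \<subseteq> V - U" "card K = r - card U"
      have "finite K" using K(1) assms(1) by (meson finite_Diff finite_subset)
      then have "card (U \<union> K) = r" using K finU assms(3) by (subst card_Un_disjoint) auto
      then show "U \<union> K \<in> nsets V r \<and> U \<subseteq> U \<union> K"
        using K assms(2) finU \<open>finite K\<close> by (auto simp: nsets_def)
    qed
  qed (use finN in auto)
  finally show ?thesis .
qed

section \<open>Bad sets and monochromatic Berge cycles\<close>

definition color_degree :: "'a set \<Rightarrow> nat \<Rightarrow> ('a set \<Rightarrow> nat) \<Rightarrow> nat \<Rightarrow> 'a set \<Rightarrow> nat" where
  "color_degree V r c i T = card {e \<in> nsets V r. T \<subseteq> e \<and> c e = i}"

text \<open>This is the edge set of the graph \<open>G i\<close> in the introduction.\<close>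

definition good_pairs :: "'a set \<Rightarrow> nat \<Rightarrow> nat \<Rightarrow> ('a set \<Rightarrow> nat) \<Rightarrow> nat \<Rightarrow> 'a set set" where
  "good_pairs V r t c i = {p \<in> nsets V 2. \<forall>T\<in>nsets V t. p \<subseteq> T \<longrightarrow> r - t < color_degree V r c i T}"

lemma good_pairs_cycle_imp_berge_cycle:
  assumes t: "2 \<le> t" "t < r" and V: "finite V" "r < card V"
    and ham: "hamiltonian_cycle V (good_pairs V r t c i) vs"
  shows "\<exists>es. hamiltonian_tight_berge_cycle r t V (nsets V r) vs es \<and> monochromatic_edges c es"
proof -
  let ?n = "length vs"
  have vs: "distinct vs" "set vs = V" using ham by (auto simp: hamiltonian_cycle_def)
  have len: "?n = card V" using vs distinct_card by metis
  have n: "0 < ?n" using V len by simp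
  define W where "W j = (\<lambda>l. vs ! ((j + l) mod ?n)) ` {..<t}" for j
  define N where "N j = {e \<in> nsets V r. W j \<subseteq> e \<and> c e = i}" for j
  have WV: "W j \<subseteq> V" for j using n vs(2) by (auto simp: W_def)
  have cW: "card (W j) = t" for j
  proof -
    have "inj_on (\<lambda>l. (j + l) mod ?n) {..<t}"
      using t V len by (intro inj_on_add_mod) simp
    then have "inj_on (\<lambda>l. vs ! ((j + l) mod ?n)) {..<t}"
      using vs(1) n by (simp add: inj_on_def nth_eq_iff_index_eq)
    then show ?thesis by (simp add: W_def card_image)
  qed
  have finN: "finite (N j)" for j
    using finite_imp_finite_nsets[OF V(1)] by (simp add: N_def)
  have "\<exists>f. inj_on f {..<?n} \<and> (\<forall>j\<in>{..<?n}. f j \<in> N j)"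
  \<comment> \<open>The same \<open>d\<close> bounds the edges per window from below and the windows
    per edge from above.\<close>
  proof (rule distinct_representatives_of_degrees[where d="r - t + 1"])
    fix j assume "j \<in> {..<?n}"
    then have j: "j < ?n" by simp
    \<comment> \<open>Since \<open>2 \<le> t\<close>, each window contains a cycle edge, so goodness
      of that pair applies to the window.\<close>
    have "vs ! ((j + 0) mod ?n) \<in> W j" "vs ! ((j + 1) mod ?n) \<in> W j"
      unfolding W_def using t by (intro imageI; simp)+
    then have "{vs ! j, vs ! (Suc j mod ?n)} \<subseteq> W j" using j by simp
    moreover have "{vs ! j, vs ! (Suc j mod ?n)} \<in> good_pairs V r t c i"
      using ham j by (simp add: hamiltonian_cycle_def)
    moreover have "W j \<in> nsets V t" using WV cW V(1) by (auto simp: nsets_def intro: finite_subset)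
    ultimately have "r - t < color_degree V r c i (W j)" by (auto simp: good_pairs_def)
    then show "r - t + 1 \<le> card (N j)" by (simp add: color_degree_def N_def)
  next
    fix e
    show "card {j \<in> {..<?n}. e \<in> N j} \<le> r - t + 1"
    proof (cases "e \<in> nsets V r")
      case True
      have "{j \<in> {..<?n}. e \<in> N j} \<subseteq> {j \<in> {..<?n}. \<forall>l<t. vs ! ((j + l) mod ?n) \<in> e}"
        by (auto simp: N_def W_def)
      then have "card {j \<in> {..<?n}. e \<in> N j} \<le> card {j \<in> {..<?n}. \<forall>l<t. vs ! ((j + l) mod ?n) \<in> e}"
        by (intro card_mono) auto
      also have "\<dots> \<le> r - t + 1"
        using True vs t V len by (intro card_windows_in_edge) (auto simp: nsets_def)
      finally show ?thesis .
    qed (simp add: N_def)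
  qed (use finN in auto)
  then obtain f where f: "inj_on f {..<?n}" "\<And>j. j < ?n \<Longrightarrow> f j \<in> N j" by blast
  let ?es = "map f [0..<?n]"
  have "distinct ?es" using f(1) by (simp add: distinct_map atLeast0LessThan)
  moreover have "set ?es \<subseteq> nsets V r" using f(2) by (auto simp: N_def)
  moreover have "\<forall>j<?n. \<forall>l<t. vs ! ((j + l) mod ?n) \<in> ?es ! j"
    using f(2) by (auto simp: N_def W_def)
  moreover have "\<forall>e\<in>set ?es. c e = i" using f(2) by (auto simp: N_def)
  ultimately show ?thesis
    using vs len t V unfolding hamiltonian_tight_berge_cycle_def tight_berge_cycle_def
      uniform_hypergraph_def monochromatic_edges_def
    by (intro exI[of _ ?es]) auto
qed

text \<open>The numbers clash: \<open>card V - (k * (t - 1) + 1)\<close> edges contain all bad sets,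
  but badness allows only \<open>k * (r - t)\<close> in total, whereas \<open>card V\<close> is at
  least \<open>k * (r - 1) + 2\<close>.\<close>

lemma no_rainbow_bad_pairs:
  assumes t: "2 \<le> t" "t < r" and V: "finite V"
    and k: "k * (t - 1) + 2 \<le> r" "(r - 1) * k + 2 \<le> card V" "0 < k"
    and c: "c \<in> nsets V r \<rightarrow> {..<k}"
    and A: "A \<subseteq> V" "card A \<le> Suc k"
    and bad: "\<And>i. i < k \<Longrightarrow> \<exists>x\<in>A. \<exists>y\<in>A. x \<noteq> y \<and> {x, y} \<notin> good_pairs V r t c i"
  shows False
proof -
  let ?s = "k * (t - 1) + 1"
  have rn: "r < card V"
  proof -
    have "(r - 1) * 1 \<le> (r - 1) * k" using k(3) by (intro mult_le_mono) auto
    then show ?thesis using k(2) by linarith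
  qed
  have "\<exists>p T. p \<subseteq> A \<and> card p = 2 \<and> T \<in> nsets V t \<and> p \<subseteq> T \<and> color_degree V r c i T \<le> r - t" if "i < k" for i
  proof -
    obtain x y where xy: "x \<in> A" "y \<in> A" "x \<noteq> y" "{x, y} \<notin> good_pairs V r t c i"
      using bad[OF \<open>i < k\<close>] by blast
    moreover have "{x, y} \<in> nsets V 2" using xy A(1) by auto
    ultimately obtain T where "T \<in> nsets V t" "{x, y} \<subseteq> T" "\<not> r - t < color_degree V r c i T"
      unfolding good_pairs_def by blast
    then show ?thesis using xy by (intro exI[of _ "{x, y}"] exI[of _ T]) auto
  qed
  then obtain p T where pT: "\<And>i. i < k \<Longrightarrow> p i \<subseteq> A \<and> card (p i) = 2 \<and> T i \<in> nsets V t \<and> p i \<subseteq> T i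
      \<and> color_degree V r c i (T i) \<le> r - t" by metis
  have TV: "T i \<subseteq> V" "finite (T i)" "card (T i) = t" if "i < k" for i
    using pT[OF that] by (auto simp: nsets_def)
  have finA: "finite A" using A V finite_subset by blast
  let ?B = "A \<union> (\<Union>i<k. T i - p i)"
  \<comment> \<open>Each \<open>T i\<close> already has two vertices in \<open>A\<close>, so it adds
    at most \<open>t - 2\<close> new ones.\<close>
  have "card ?B \<le> card A + card (\<Union>i<k. T i - p i)" by (rule card_Un_le)
  also have "card (\<Union>i<k. T i - p i) \<le> (\<Sum>i<k. card (T i - p i))" by (rule card_UN_le) simp
  also have "\<dots> = (\<Sum>i<k. t - 2)"
  proof (rule sum.cong)
    fix i assume "i \<in> {..<k}"
    then have i: "i < k" by simp
    have "finite (p i)" using pT[OF i] finA finite_subset by blast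
    then show "card (T i - p i) = t - 2" using pT[OF i] TV[OF i] by (simp add: card_Diff_subset)
  qed simp
  also have "card A + \<dots> \<le> Suc k + k * (t - 2)" using A(2) by simp
  also have "\<dots> = ?s"
  proof -
    have "t - 1 = Suc (t - 2)" using t by simp
    then show ?thesis by simp
  qed
  finally have cB: "card ?B \<le> ?s" by simp
  have "?B \<subseteq> V" using A TV by fastforce
  \<comment> \<open>Padding to exactly \<open>?s\<close> vertices fixes the count;
    \<open>?s < r\<close> leaves room to extend \<open>U\<close> to edges.\<close>
  moreover have "?s \<le> card V" using k(1) rn by simp
  ultimately obtain U where U: "?B \<subseteq> U" "U \<subseteq> V" "card U = ?s"
    using exists_subset_between[OF cB _ _ V] by blast
  have TU: "T i \<subseteq> U" if "i < k" for i using U(1) pT[OF that] that by blast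
  have fin: "finite (nsets V r)" using V by (rule finite_imp_finite_nsets)
  have "card V - ?s \<le> card {e \<in> nsets V r. U \<subseteq> e}"
    using card_supersets_ge[OF V U(2), of r] U(3) k(1) rn by simp
  \<comment> \<open>An edge containing \<open>U\<close> has some colour \<open>i < k\<close> and
    contains the bad set \<open>T i\<close> of that very colour.\<close>
  also have "\<dots> \<le> card (\<Union>i<k. {e \<in> nsets V r. T i \<subseteq> e \<and> c e = i})"
    using TU c fin by (intro card_mono) (auto simp: Pi_iff, blast)
  also have "\<dots> \<le> (\<Sum>i<k. color_degree V r c i (T i))"
    unfolding color_degree_def by (rule card_UN_le) simp
  also have "\<dots> \<le> (\<Sum>i<k. r - t)" using pT by (intro sum_mono) auto
  finally have "card V \<le> k * (r - t) + k * (t - 1) + 1" by simp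
  also have "\<dots> = k * (r - 1) + 1"
    using t by (simp add: distrib_left[symmetric])
  finally show False using k(2) by (simp add: mult.commute)
qed

theorem theorem2p2:
  fixes r t n :: nat and V :: "'a set" and c :: "'a set \<Rightarrow> nat"
  assumes "2 \<le> t" and "t < r"
    and "n \<ge> (r - 1) * ((r - 2) div (t - 1)) + 2"
    and "finite V" and "card V = n"
    and "edge_coloring (nsets V r) ((r - 2) div (t - 1)) c"
  shows "\<exists>vs es. hamiltonian_tight_berge_cycle r t V (nsets V r) vs es \<and> monochromatic_edges c es"
proof -
  define k where "k = (r - 2) div (t - 1)"
  \<comment> \<open>From \<open>t < r\<close> comes \<open>t - 1 \<le> r - 2\<close>, so there is at
    least one colour; this in turn gives \<open>r < card V\<close>.\<close>
  have "0 < k" using assms(1,2) by (simp add: k_def div_greater_zero_iff)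
  have "k * (t - 1) \<le> r - 2" by (simp add: k_def)
  then have kr: "k * (t - 1) + 2 \<le> r" using assms(1,2) by linarith
  have kn: "(r - 1) * k + 2 \<le> card V" using assms(3,5) by (simp add: k_def)
  have c: "c \<in> nsets V r \<rightarrow> {..<k}" using assms(6) by (simp add: edge_coloring_def k_def)
  have "(r - 1) * 1 \<le> (r - 1) * k" using \<open>0 < k\<close> by (intro mult_le_mono) auto
  then have rn: "r < card V" using kn by linarith
  have "\<exists>i<k. \<exists>vs. hamiltonian_cycle V (good_pairs V r t c i) vs"
  proof (rule ccontr)
    assume "\<not> ?thesis"
    then have "\<exists>A \<subseteq> V. card A \<le> Suc k \<and> (\<forall>i<k. \<exists>x\<in>A. \<exists>y\<in>A. x \<noteq> y \<and> {x, y} \<notin> good_pairs V r t c i)"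
      using assms(1,2,4) rn by (intro rainbow_nonedges) (auto simp: good_pairs_def)
    then show False
      using no_rainbow_bad_pairs[OF assms(1,2,4) kr kn \<open>0 < k\<close> c] by metis
  qed
  then show ?thesis
    using good_pairs_cycle_imp_berge_cycle[OF assms(1,2,4) rn] by metis
qed

end
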